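(* Let $K\ge1$, $\alpha\in(0,1)$, and let $X_1,\dots,X_K$ be arbitrarily dependent e-values for the null hypothesis $H_0:P\in\mathcal P$. If the $X_i$ are not exchangeable, let $\pi$ be a uniformly random permutation of $\{1,\dots,K\}$ drawn independently of $(X_1,\dots,X_K)$; otherwise let $\pi$ be the identity permutation. Let $U$ be uniform on $[0,1]$, independent of $(X_1,\dots,X_K)$ and $\pi$. Write $\bar X_K=\frac1K\sum_{i=1}^KX_i$ and $\bar X_t^\pi=\frac1t\sum_{i=1}^tX_{\pi(i)}$ for $1\le t\le K$. Then each of the following rules controls the type-I error at level $\alpha$: (1) reject $H_0$ if $\bar X_K\ge U/\alpha$; (2) reject $H_0$ if $\sup_{1\le t\le K}\bar X_t^\pi\ge1/\alpha$; (3) reject $H_0$ if $X_{\pi(1)}\ge U/\alpha$ or $\sup_{1\le t\le K}\bar X_t^\pi\ge1/\alpha$. Further, each of these rules is more powerful than the rule that rejects $H_0$ if $\bar X_K\ge1/\alpha$.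
   Context: $\mathcal P$ is a set of distributions. An e-value for $H_0:P\in\mathcal P$ is a nonnegative random variable $X$ with $\mathbb E_P[X]\le1$ for all $P\in\mathcal P$. A rule controls the type-I error at level $\alpha$ if, for every $P\in\mathcal P$, its rejection probability under $P$ (including the external randomness $U,\pi$) is at most $\alpha$. Exchangeability (under each $P\in\mathcal P$) means $(X_1,\dots,X_K)$ has the same law as $(X_{\sigma(1)},\dots,X_{\sigma(K)})$ for every permutation $\sigma$. "More powerful" is meant in the weak (never worse) sense: the rule rejects whenever the compared rule rejects. *)

theory Defs
  imports "HOL-Probability.Probability"
begin

text \<open>
  The null hypothesis is a set \<open>\<P>\<close> of probability measures on one measurable space \<open>M\<close>, of which
  only the space and the sigma-algebra matter.  The e-values and the external randomness (\<open>U\<close> and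
  \<open>\<pi>\<close>) are random variables on \<open>M\<close>.  This includes the case where the space carrying the data is
  enlarged by a product in order to accommodate \<open>U\<close> and \<open>\<pi>\<close>.
\<close>

definition e_value :: "'a measure \<Rightarrow> 'a measure set \<Rightarrow> ('a \<Rightarrow> real) \<Rightarrow> bool" where
  "e_value M \<P> X \<longleftrightarrow>
     X \<in> borel_measurable M \<and> (\<forall>\<omega>\<in>space M. 0 \<le> X \<omega>) \<and>
     (\<forall>P\<in>\<P>. integrable P X \<and> integral\<^sup>L P X \<le> 1)"

text \<open>A rule is given by the outcomes at which it rejects.  Since \<open>measure\<close> vanishes on
  non-measurable sets, measurability of the rejection event is part of the requirement.\<close>

definition controls_type_I_error :: "'a measure set \<Rightarrow> real \<Rightarrow> ('a \<Rightarrow> bool) \<Rightarrow> bool" where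
  "controls_type_I_error \<P> \<alpha> R \<longleftrightarrow>
     (\<forall>P\<in>\<P>. {\<omega> \<in> space P. R \<omega>} \<in> sets P \<and> measure P {\<omega> \<in> space P. R \<omega>} \<le> \<alpha>)"

text \<open>The weak sense: \<open>R\<close> rejects whenever \<open>S\<close> does.\<close>

definition more_powerful :: "'a measure \<Rightarrow> ('a \<Rightarrow> bool) \<Rightarrow> ('a \<Rightarrow> bool) \<Rightarrow> bool" where
  "more_powerful M R S \<longleftrightarrow> (\<forall>\<omega>\<in>space M. S \<omega> \<longrightarrow> R \<omega>)"

definition joint :: "nat \<Rightarrow> (nat \<Rightarrow> 'a \<Rightarrow> real) \<Rightarrow> 'a \<Rightarrow> nat \<Rightarrow> real" where
  "joint K X = (\<lambda>\<omega>. \<lambda>i\<in>{1..K}. X i \<omega>)"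

abbreviation joint_space :: "nat \<Rightarrow> (nat \<Rightarrow> real) measure" where
  "joint_space K \<equiv> \<Pi>\<^sub>M i\<in>{1..K}. (borel :: real measure)"

definition exchangeable :: "'a measure set \<Rightarrow> nat \<Rightarrow> (nat \<Rightarrow> 'a \<Rightarrow> real) \<Rightarrow> bool" where
  "exchangeable \<P> K X \<longleftrightarrow>
     (\<forall>P\<in>\<P>. \<forall>\<sigma>. \<sigma> permutes {1..K} \<longrightarrow>
        distr P (joint_space K) (joint K (\<lambda>i. X (\<sigma> i))) = distr P (joint_space K) (joint K X))"

text \<open>The library's \<open>indep_var\<close> only relates random variables with values in the same type, so
  independence is expressed through \<open>indep_set\<close> for the generated sigma-algebras.\<close>

definition independent_rvs ::
    "'a measure \<Rightarrow> 'b measure \<Rightarrow> ('a \<Rightarrow> 'b) \<Rightarrow> 'c measure \<Rightarrow> ('a \<Rightarrow> 'c) \<Rightarrow> bool" where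
  "independent_rvs P N Y N' Z \<longleftrightarrow>
     prob_space.indep_set P (sets (vimage_algebra (space P) Y N)) (sets (vimage_algebra (space P) Z N'))"

abbreviation perm_space :: "nat \<Rightarrow> (nat \<Rightarrow> nat) measure" where
  "perm_space K \<equiv> count_space {\<sigma>. \<sigma> permutes {1..K}}"

definition uniform_perm :: "'a measure \<Rightarrow> nat \<Rightarrow> ('a \<Rightarrow> nat \<Rightarrow> nat) \<Rightarrow> bool" where
  "uniform_perm P K \<pi> \<longleftrightarrow>
     distr P (perm_space K) \<pi> = uniform_count_measure {\<sigma>. \<sigma> permutes {1..K}}"

definition uniform_unit :: "'a measure \<Rightarrow> ('a \<Rightarrow> real) \<Rightarrow> bool" where
  "uniform_unit P U \<longleftrightarrow> distr P borel U = uniform_measure lborel {0..1}"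

definition avg :: "(nat \<Rightarrow> 'a \<Rightarrow> real) \<Rightarrow> nat \<Rightarrow> 'a \<Rightarrow> real" where
  "avg X t \<omega> = (\<Sum>i=1..t. X i \<omega>) / real t"

definition perm_avg :: "(nat \<Rightarrow> 'a \<Rightarrow> real) \<Rightarrow> ('a \<Rightarrow> nat \<Rightarrow> nat) \<Rightarrow> nat \<Rightarrow> 'a \<Rightarrow> real" where
  "perm_avg X \<pi> t \<omega> = (\<Sum>i=1..t. X (\<pi> \<omega> i) \<omega>) / real t"

definition rule_plain :: "nat \<Rightarrow> real \<Rightarrow> (nat \<Rightarrow> 'a \<Rightarrow> real) \<Rightarrow> 'a \<Rightarrow> bool" where
  "rule_plain K \<alpha> X \<omega> \<longleftrightarrow> avg X K \<omega> \<ge> 1 / \<alpha>"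

definition rule_randomized ::
    "nat \<Rightarrow> real \<Rightarrow> (nat \<Rightarrow> 'a \<Rightarrow> real) \<Rightarrow> ('a \<Rightarrow> real) \<Rightarrow> 'a \<Rightarrow> bool" where
  "rule_randomized K \<alpha> X U \<omega> \<longleftrightarrow> avg X K \<omega> \<ge> U \<omega> / \<alpha>"

definition rule_permuted ::
    "nat \<Rightarrow> real \<Rightarrow> (nat \<Rightarrow> 'a \<Rightarrow> real) \<Rightarrow> ('a \<Rightarrow> nat \<Rightarrow> nat) \<Rightarrow> 'a \<Rightarrow> bool" where
  "rule_permuted K \<alpha> X \<pi> \<omega> \<longleftrightarrow> (SUP t\<in>{1..K}. perm_avg X \<pi> t \<omega>) \<ge> 1 / \<alpha>"

definition rule_permuted_randomized ::
    "nat \<Rightarrow> real \<Rightarrow> (nat \<Rightarrow> 'a \<Rightarrow> real) \<Rightarrow> ('a \<Rightarrow> nat \<Rightarrow> nat) \<Rightarrow> ('a \<Rightarrow> real) \<Rightarrow> 'a \<Rightarrow> bool" where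
  "rule_permuted_randomized K \<alpha> X \<pi> U \<omega> \<longleftrightarrow>
     X (\<pi> \<omega> 1) \<omega> \<ge> U \<omega> / \<alpha> \<or> (SUP t\<in>{1..K}. perm_avg X \<pi> t \<omega>) \<ge> 1 / \<alpha>"

end

theory Submission
  imports Defs
begin

text \<open>
  Given the e-values and \<open>\<pi>\<close>, the event \<open>X\<^bsub>\<pi>(1)\<^esub> \<ge> U / \<alpha>\<close> has probability at most \<open>\<alpha> X\<^bsub>\<pi>(1)\<^esub>\<close>, so the
  third rule rejects with probability at most the expectation of \<open>1\<close> on the event \<open>A\<close> that some
  running average reaches \<open>1 / \<alpha>\<close>, and of \<open>\<alpha> X\<^bsub>\<pi>(1)\<^esub>\<close> off \<open>A\<close>.  Under exchangeability, as well as under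
  a uniform independent \<open>\<pi>\<close>, this expectation is an average over all fixed permutations, and it
  remains to see that for fixed numbers \<open>x\<^sub>1, \<dots>, x\<^sub>K\<close> the permutations in \<open>A\<close> number at most the sum
  of \<open>\<alpha> x\<^bsub>\<sigma>(1)\<^esub>\<close> over them.  Split \<open>A\<close> by the last time \<open>t\<close> at which the average is at least \<open>1 / \<alpha>\<close>:
  each piece is invariant under permuting the first \<open>t\<close> positions, so \<open>x\<^bsub>\<sigma>(1)\<^esub>\<close> may be replaced by
  the average of the first \<open>t\<close> values, which is at least \<open>1 / \<alpha>\<close> there.  This is the reverse
  martingale argument behind Ville's inequality, in finite form.
\<close>

section \<open>Counting permutations by the last time a running average is high\<close>

text \<open>The argument is a bare sequence of numbers, so the same predicate serves for fixed
  rearrangements, for the permuted e-values and for points of the product space. A finite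
  disjunction over times makes its measurability immediate.\<close>

definition average_reaches :: "nat \<Rightarrow> real \<Rightarrow> (nat \<Rightarrow> real) \<Rightarrow> bool" where
  "average_reaches K c y \<longleftrightarrow> (\<exists>t\<in>{1..K}. c \<le> (\<Sum>i=1..t. y i) / real t)"

lemma sum_permutes_running_average_le:
  fixes x :: "nat \<Rightarrow> real"
  assumes \<alpha>: "0 < \<alpha>"
  shows "(\<Sum>\<sigma> | \<sigma> permutes {1..K}. if average_reaches K (1 / \<alpha>) (\<lambda>i. x (\<sigma> i)) then 1 else \<alpha> * x (\<sigma> 1))
    \<le> (\<Sum>\<sigma> | \<sigma> permutes {1..K}. \<alpha> * x (\<sigma> 1))"
proof -
  define S where "S = {\<sigma>. \<sigma> permutes {1..K}}"
  define a where "a \<sigma> t = (\<Sum>i=1..t. x (\<sigma> i)) / real t" for \<sigma> :: "nat \<Rightarrow> nat" and t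
  define A where "A = {\<sigma>\<in>S. \<exists>t\<in>{1..K}. 1 / \<alpha> \<le> a \<sigma> t}"
  define B where "B t = {\<sigma>\<in>S. 1 / \<alpha> \<le> a \<sigma> t \<and> (\<forall>s\<in>{t<..K}. a \<sigma> s < 1 / \<alpha>)}" for t
  have finS: "finite S"
    unfolding S_def by (rule finite_permutations) simp
  have A_eq: "A = (\<Union>t\<in>{1..K}. B t)"
  proof (intro equalityI subsetI)
    fix \<sigma> assume "\<sigma> \<in> A"
    define T where "T = {t\<in>{1..K}. 1 / \<alpha> \<le> a \<sigma> t}"
    have T: "finite T" "T \<noteq> {}"
      using \<open>\<sigma> \<in> A\<close> by (auto simp: T_def A_def)
    have "a \<sigma> s < 1 / \<alpha>" if "s \<in> {Max T<..K}" for s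
    proof (rule ccontr)
      assume "\<not> a \<sigma> s < 1 / \<alpha>"
      with that have "s \<in> T" by (auto simp: T_def)
      with T that show False by (auto dest: Max_ge)
    qed
    moreover have "Max T \<in> T"
      using T by (rule Max_in)
    ultimately show "\<sigma> \<in> (\<Union>t\<in>{1..K}. B t)"
      using \<open>\<sigma> \<in> A\<close> by (auto simp: T_def A_def B_def)
  qed (auto simp: A_def B_def)
  have B_disj: "B t \<inter> B s = {}" if "t \<noteq> s" "t \<in> {1..K}" "s \<in> {1..K}" for t s
    using that by (cases t s rule: linorder_cases) (force simp: B_def)+
  have B_le: "(\<Sum>\<sigma>\<in>B t. 1) \<le> (\<Sum>\<sigma>\<in>B t. \<alpha> * x (\<sigma> 1))" if t: "t \<in> {1..K}" for t
  proof -
    have swap: "(\<Sum>\<sigma>\<in>B t. x (\<sigma> i)) = (\<Sum>\<sigma>\<in>B t. x (\<sigma> 1))" if i: "i \<in> {1..t}" for i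
    proof -
      let ?p = "Transposition.transpose 1 i :: nat \<Rightarrow> nat"
      \<comment> \<open>An average over at least \<open>t\<close> terms does not see the order of
        the first \<open>t\<close> positions. Membership in \<open>B t\<close> constrains only
        averages at times from \<open>t\<close> on, which is why the split is by the last time and
        not by the first.\<close>
      have a_swap: "a (\<sigma> \<circ> ?p) s = a \<sigma> s" if "t \<le> s" for \<sigma> s
      proof -
        have "?p permutes {1..s}"
          using i that by (intro permutes_swap_id) auto
        from sum.permute[OF this, of "\<lambda>i. x (\<sigma> i)"] show ?thesis
          by (simp add: a_def o_def)
      qed
      have "?p permutes {1..K}"
        using i t by (intro permutes_swap_id) auto
      hence closed: "\<sigma> \<circ> ?p \<in> B t" if "\<sigma> \<in> B t" for \<sigma>
        using that a_swap by (auto simp: B_def S_def intro!: permutes_compose)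
      \<comment> \<open>Composition with a transposition is an involution of \<open>B t\<close>, and
        it moves the value at position \<open>i\<close> to position 1.\<close>
      show ?thesis
        by (rule sum.reindex_bij_witness[where i = "\<lambda>\<sigma>. \<sigma> \<circ> ?p" and j = "\<lambda>\<sigma>. \<sigma> \<circ> ?p"])
           (use closed in \<open>auto simp: o_assoc[symmetric]\<close>)
    qed
    \<comment> \<open>The factor \<open>t\<close> clears the denominator of
      \<open>a \<sigma> t\<close>, so that the double sum can be exchanged; it is cancelled at the
      end because \<open>t\<close> is positive.\<close>
    have "real t * (\<Sum>\<sigma>\<in>B t. 1 / \<alpha>) \<le> real t * (\<Sum>\<sigma>\<in>B t. a \<sigma> t)"
      by (intro mult_left_mono sum_mono) (auto simp: B_def)
    also have "\<dots> = (\<Sum>\<sigma>\<in>B t. \<Sum>i=1..t. x (\<sigma> i))"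
      using t by (subst sum_distrib_left) (simp add: a_def)
    also have "\<dots> = (\<Sum>i=1..t. \<Sum>\<sigma>\<in>B t. x (\<sigma> i))"
      by (rule sum.swap)
    also have "\<dots> = (\<Sum>i=1..t. \<Sum>\<sigma>\<in>B t. x (\<sigma> 1))"
      by (intro sum.cong swap) auto
    also have "\<dots> = real t * (\<Sum>\<sigma>\<in>B t. x (\<sigma> 1))"
      by simp
    finally have "(\<Sum>\<sigma>\<in>B t. 1 / \<alpha>) \<le> (\<Sum>\<sigma>\<in>B t. x (\<sigma> 1))"
      by (rule mult_left_le_imp_le) (use t in simp)
    hence "\<alpha> * (\<Sum>\<sigma>\<in>B t. 1 / \<alpha>) \<le> \<alpha> * (\<Sum>\<sigma>\<in>B t. x (\<sigma> 1))"
      using \<alpha> by (intro mult_left_mono) auto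
    thus ?thesis
      using \<alpha> by (simp add: sum_distrib_left)
  qed
  have sum_A: "(\<Sum>\<sigma>\<in>A. f \<sigma>) = (\<Sum>t=1..K. \<Sum>\<sigma>\<in>B t. f \<sigma>)" for f :: "_ \<Rightarrow> real"
    unfolding A_eq using finS B_disj
    by (intro sum.UNION_disjoint) (auto intro: finite_subset[of _ S] simp: B_def)
  have "(\<Sum>\<sigma>\<in>S. if \<sigma> \<in> A then 1 else \<alpha> * x (\<sigma> 1)) = (\<Sum>\<sigma>\<in>A. 1) + (\<Sum>\<sigma>\<in>S - A. \<alpha> * x (\<sigma> 1))"
    using finS by (subst sum.If_cases) (auto simp: A_def Int_def intro!: arg_cong2[where f = plus] sum.cong)
  also have "\<dots> \<le> (\<Sum>\<sigma>\<in>A. \<alpha> * x (\<sigma> 1)) + (\<Sum>\<sigma>\<in>S - A. \<alpha> * x (\<sigma> 1))"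
    unfolding sum_A by (intro add_right_mono sum_mono B_le)
  also have "\<dots> = (\<Sum>\<sigma>\<in>S. \<alpha> * x (\<sigma> 1))"
    using finS by (subst sum.subset_diff[of A S]) (auto simp: A_def)
  finally have "(\<Sum>\<sigma>\<in>S. if \<sigma> \<in> A then 1 else \<alpha> * x (\<sigma> 1)) \<le> (\<Sum>\<sigma>\<in>S. \<alpha> * x (\<sigma> 1))" .
  moreover have "\<sigma> \<in> A \<longleftrightarrow> average_reaches K (1 / \<alpha>) (\<lambda>i. x (\<sigma> i))" if "\<sigma> \<in> S" for \<sigma>
    using that by (simp add: A_def a_def average_reaches_def)
  ultimately show ?thesis
    unfolding S_def[symmetric] by (simp cong: sum.cong)
qed

section \<open>Independence and the uniform threshold\<close>

text \<open>A measurable function of \<open>Y\<close> generates a sub-sigma-algebra of the one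
  generated by \<open>Y\<close>, and independence passes to smaller families of events. Mapping both
  sides into a common value type gives access to the results on \<open>indep_var\<close>.\<close>

lemma (in prob_space) independent_rvs_imp_indep_var:
  assumes indep: "independent_rvs M N Y N' Z"
    and Y [measurable]: "Y \<in> M \<rightarrow>\<^sub>M N" and Z [measurable]: "Z \<in> M \<rightarrow>\<^sub>M N'"
    and g [measurable]: "g \<in> N \<rightarrow>\<^sub>M L" and h [measurable]: "h \<in> N' \<rightarrow>\<^sub>M L'"
  shows "indep_var L (\<lambda>\<omega>. g (Y \<omega>)) L' (\<lambda>\<omega>. h (Z \<omega>))"
proof -
  have sub: "sigma_sets (space M) {(\<lambda>\<omega>. k (V \<omega>)) -` A \<inter> space M | A. A \<in> sets C}
      \<subseteq> sets (vimage_algebra (space M) V B)"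
    if V: "V \<in> M \<rightarrow>\<^sub>M B" and k: "k \<in> B \<rightarrow>\<^sub>M C" for V k B C
  proof -
    have "V \<in> vimage_algebra (space M) V B \<rightarrow>\<^sub>M B"
      using V by (intro measurable_vimage_algebra1) (auto simp: measurable_space)
    from measurable_compose[OF this k]
    have kV: "(\<lambda>\<omega>. k (V \<omega>)) \<in> vimage_algebra (space M) V B \<rightarrow>\<^sub>M C" .
    have "{(\<lambda>\<omega>. k (V \<omega>)) -` A \<inter> space M | A. A \<in> sets C} \<subseteq> sets (vimage_algebra (space M) V B)"
      using measurable_sets[OF kV] by auto
    from sets.sigma_sets_subset[OF this] show ?thesis
      by simp
  qed
  show ?thesis
    unfolding indep_var_eq
  proof (intro conjI)
    show "indep_set (sigma_sets (space M) {(\<lambda>\<omega>. g (Y \<omega>)) -` A \<inter> space M | A. A \<in> sets L})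
        (sigma_sets (space M) {(\<lambda>\<omega>. h (Z \<omega>)) -` A \<inter> space M | A. A \<in> sets L'})"
      using indep[unfolded independent_rvs_def] sub[OF Y g] sub[OF Z h]
      unfolding indep_sets2_eq by (meson subset_iff)
  qed measurable
qed

text \<open>By independence the joint law is a product, and Fubini integrates over \<open>U\<close>
  first: for fixed \<open>w\<close> the event has as probability the length of the part of [0,1] up
  to \<open>w\<close>. Negative values of \<open>W\<close> contribute zero on both sides, since
  \<open>ennreal\<close> truncates them.\<close>

lemma (in prob_space) emeasure_uniform_unit_le:
  assumes U: "uniform_unit M U" and indep: "indep_var borel U borel W"
  shows "emeasure M {\<omega> \<in> space M. U \<omega> \<le> W \<omega>} \<le> (\<integral>\<^sup>+\<omega>. ennreal (W \<omega>) \<partial>M)"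
proof -
  have U_meas [measurable]: "random_variable borel U" and W_meas [measurable]: "random_variable borel W"
    using indep by (auto dest: indep_var_rv1 indep_var_rv2)
  interpret U: prob_space "distr M borel U" by (rule prob_space_distr) measurable
  interpret W: prob_space "distr M borel W" by (rule prob_space_distr) measurable
  interpret UW: pair_sigma_finite "distr M borel U" "distr M borel W" ..
  define D where "D = {p \<in> space (borel \<Otimes>\<^sub>M borel). (fst p :: real) \<le> snd p}"
  have D [measurable]: "D \<in> sets (borel \<Otimes>\<^sub>M borel)"
    unfolding D_def by (rule borel_measurable_le) simp_all
  have "emeasure M {\<omega> \<in> space M. U \<omega> \<le> W \<omega>} = emeasure (distr M (borel \<Otimes>\<^sub>M borel) (\<lambda>\<omega>. (U \<omega>, W \<omega>))) D"
    by (subst emeasure_distr[OF _ D]) (auto simp: D_def space_pair_measure intro!: arg_cong[where f = "emeasure M"])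
  also have "\<dots> = emeasure (distr M borel U \<Otimes>\<^sub>M distr M borel W) D"
    using indep by (simp add: indep_var_distribution_eq)
  also have "\<dots> = (\<integral>\<^sup>+w. emeasure (distr M borel U) ((\<lambda>u. (u, w)) -` D) \<partial>distr M borel W)"
    by (rule UW.emeasure_pair_measure_alt2) simp
  also have "\<dots> \<le> (\<integral>\<^sup>+w. ennreal w \<partial>distr M borel W)"
  proof (rule nn_integral_mono)
    fix w :: real
    have "(\<lambda>u. (u, w)) -` D = {..w}"
      by (auto simp: D_def space_pair_measure)
    hence "emeasure (distr M borel U) ((\<lambda>u. (u, w)) -` D) = emeasure lborel ({0..1} \<inter> {..w})"
      using U by (simp add: uniform_unit_def divide_ennreal_def)
    \<comment> \<open>For negative \<open>w\<close> the enclosing interval shrinks to the point 0,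
      of measure zero, in agreement with \<open>ennreal w = 0\<close>.\<close>
    also have "\<dots> \<le> emeasure lborel {0..max 0 w}"
      by (intro emeasure_mono) auto
    also have "\<dots> = ennreal w"
      by (simp add: max_def ennreal_neg)
    finally show "emeasure (distr M borel U) ((\<lambda>u. (u, w)) -` D) \<le> ennreal w" .
  qed
  also have "\<dots> = (\<integral>\<^sup>+\<omega>. ennreal (W \<omega>) \<partial>M)"
    by (subst nn_integral_distr) auto
  finally show ?thesis .
qed

section \<open>Averaging over a uniform independent permutation\<close>

lemma (in prob_space) nn_integral_indep_var_mult:
  fixes Y Z :: "'a \<Rightarrow> ennreal"
  assumes "indep_var borel Y borel Z"
  shows "(\<integral>\<^sup>+\<omega>. Y \<omega> * Z \<omega> \<partial>M) = (\<integral>\<^sup>+\<omega>. Y \<omega> \<partial>M) * (\<integral>\<^sup>+\<omega>. Z \<omega> \<partial>M)"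
proof -
  \<comment> \<open>\<open>indep_var\<close> is independence of a family indexed by
    \<open>bool\<close>; its family of targets has to be recognised as constant before the product
    formula applies.\<close>
  have "case_bool borel borel = (\<lambda>_. borel :: ennreal measure)"
    by (auto simp: fun_eq_iff split: bool.split)
  with assms have "indep_vars (\<lambda>_. borel) (case_bool Y Z) UNIV"
    by (simp add: indep_var_def)
  from indep_vars_nn_integral[OF _ this] show ?thesis
    by (simp add: UNIV_bool mult.commute)
qed

text \<open>Split according to the finitely many values of \<pi>: by independence each term factors,
  and each value has probability 1/K!. Because the split is finite, measurability of
  \<open>g\<close> is needed only for one permutation at a time.\<close>

lemma (in prob_space) nn_integral_uniform_perm:
  fixes g :: "(nat \<Rightarrow> nat) \<Rightarrow> 'b \<Rightarrow> ennreal"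
  assumes \<pi> [measurable]: "\<pi> \<in> M \<rightarrow>\<^sub>M perm_space K" and unif: "uniform_perm M K \<pi>"
    and J [measurable]: "J \<in> M \<rightarrow>\<^sub>M N" and indep: "independent_rvs M (perm_space K) \<pi> N J"
    and g: "\<And>\<sigma>. \<sigma> permutes {1..K} \<Longrightarrow> g \<sigma> \<in> borel_measurable N"
  shows "(\<integral>\<^sup>+\<omega>. g (\<pi> \<omega>) (J \<omega>) \<partial>M) = (\<Sum>\<sigma> | \<sigma> permutes {1..K}. (\<integral>\<^sup>+\<omega>. g \<sigma> (J \<omega>) \<partial>M)) / fact K"
proof -
  define S where "S = {\<sigma>. \<sigma> permutes {1..K}}"
  have finS: "finite S" and cardS: "card S = fact K"
    unfolding S_def by (auto intro: finite_permutations simp: card_permutations[where n = K])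
  have \<pi>_in: "\<pi> \<omega> \<in> S" if "\<omega> \<in> space M" for \<omega>
    using measurable_space[OF \<pi> that] by (simp add: S_def)
  have gJ: "(\<lambda>\<omega>. g \<sigma> (J \<omega>)) \<in> borel_measurable M" if "\<sigma> \<in> S" for \<sigma>
    using measurable_compose[OF J g] that by (simp add: S_def)
  have ind: "(\<lambda>\<omega>. indicator {\<sigma>} (\<pi> \<omega>) :: ennreal) \<in> borel_measurable M" for \<sigma>
    by (rule measurable_compose[OF \<pi>]) simp
  have "(\<integral>\<^sup>+\<omega>. g (\<pi> \<omega>) (J \<omega>) \<partial>M) = (\<integral>\<^sup>+\<omega>. (\<Sum>\<sigma>\<in>S. indicator {\<sigma>} (\<pi> \<omega>) * g \<sigma> (J \<omega>)) \<partial>M)"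
  proof (rule nn_integral_cong)
    fix \<omega> assume "\<omega> \<in> space M"
    have "(\<Sum>\<sigma>\<in>S. indicator {\<sigma>} (\<pi> \<omega>) * g \<sigma> (J \<omega>)) = (\<Sum>\<sigma>\<in>{\<pi> \<omega>}. indicator {\<sigma>} (\<pi> \<omega>) * g \<sigma> (J \<omega>))"
      using \<pi>_in[OF \<open>\<omega> \<in> space M\<close>] finS
      by (intro sum.mono_neutral_right) (auto simp: indicator_def)
    thus "g (\<pi> \<omega>) (J \<omega>) = (\<Sum>\<sigma>\<in>S. indicator {\<sigma>} (\<pi> \<omega>) * g \<sigma> (J \<omega>))"
      by simp
  qed
  also have "\<dots> = (\<Sum>\<sigma>\<in>S. \<integral>\<^sup>+\<omega>. indicator {\<sigma>} (\<pi> \<omega>) * g \<sigma> (J \<omega>) \<partial>M)"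
    using gJ ind by (intro nn_integral_sum borel_measurable_times_ennreal) auto
  also have "\<dots> = (\<Sum>\<sigma>\<in>S. (\<integral>\<^sup>+\<omega>. g \<sigma> (J \<omega>) \<partial>M) / fact K)"
  proof (rule sum.cong)
    fix \<sigma> assume \<sigma>: "\<sigma> \<in> S"
    have "indep_var borel (\<lambda>\<omega>. indicator {\<sigma>} (\<pi> \<omega>) :: ennreal) borel (\<lambda>\<omega>. g \<sigma> (J \<omega>))"
      using \<sigma> by (intro independent_rvs_imp_indep_var[OF indep \<pi> J] g) (auto simp: S_def)
    hence "(\<integral>\<^sup>+\<omega>. indicator {\<sigma>} (\<pi> \<omega>) * g \<sigma> (J \<omega>) \<partial>M)
        = (\<integral>\<^sup>+\<omega>. indicator {\<sigma>} (\<pi> \<omega>) \<partial>M) * (\<integral>\<^sup>+\<omega>. g \<sigma> (J \<omega>) \<partial>M)"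
      by (rule nn_integral_indep_var_mult)
    also have "(\<integral>\<^sup>+\<omega>. indicator {\<sigma>} (\<pi> \<omega>) \<partial>M) = (\<integral>\<^sup>+\<tau>. indicator {\<sigma>} \<tau> \<partial>distr M (perm_space K) \<pi>)"
      by (subst nn_integral_distr[OF \<pi>]) auto
    also have "\<dots> = emeasure (uniform_count_measure S) {\<sigma>}"
      using unif \<sigma> by (subst nn_integral_indicator)
        (auto simp: uniform_perm_def S_def sets_uniform_count_measure)
    also have "\<dots> = 1 / fact K"
      using \<sigma> finS ennreal_of_nat_eq_real_of_nat[of "fact K"]
      by (simp add: emeasure_uniform_count_measure cardS divide_ennreal[symmetric] flip: ennreal_1)
    finally show "(\<integral>\<^sup>+\<omega>. indicator {\<sigma>} (\<pi> \<omega>) * g \<sigma> (J \<omega>) \<partial>M) = (\<integral>\<^sup>+\<omega>. g \<sigma> (J \<omega>) \<partial>M) / fact K"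
      by (simp add: divide_ennreal_def mult.commute)
  qed simp
  also have "\<dots> = (\<Sum>\<sigma>\<in>S. \<integral>\<^sup>+\<omega>. g \<sigma> (J \<omega>) \<partial>M) / fact K"
    by (simp add: divide_ennreal_def sum_distrib_right)
  finally show ?thesis
    by (simp add: S_def)
qed

section \<open>Running averages: attained suprema and measurability\<close>

text \<open>Over finitely many times, at least one by \<open>K \<ge> 1\<close>, the supremum is a
  maximum and hence attained.\<close>

lemma SUP_perm_avg_ge_iff:
  assumes "K \<ge> 1"
  shows "c \<le> (SUP t\<in>{1..K}. perm_avg X \<pi> t \<omega>) \<longleftrightarrow> average_reaches K c (\<lambda>i. X (\<pi> \<omega> i) \<omega>)"
proof -
  have "(SUP t\<in>{1..K}. perm_avg X \<pi> t \<omega>) = Max ((\<lambda>t. perm_avg X \<pi> t \<omega>) ` {1..K})"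
    using assms by (intro cSup_eq_Max) auto
  thus ?thesis
    using assms by (simp add: Max_ge_iff average_reaches_def perm_avg_def Bex_def)
qed

lemma average_reaches_cong:
  assumes "\<And>i. i \<in> {1..K} \<Longrightarrow> x i = y i"
  shows "average_reaches K c x \<longleftrightarrow> average_reaches K c y"
proof -
  have "(\<Sum>i=1..t. x i) = (\<Sum>i=1..t. y i)" if "t \<in> {1..K}" for t
    using that assms by (intro sum.cong) auto
  thus ?thesis
    unfolding average_reaches_def by (intro bex_cong) auto
qed

text \<open>Removes the restriction built into \<open>joint\<close>, as the running averages read
  only indices from 1 to \<open>K\<close>.\<close>

lemma average_reaches_restrict:
  "average_reaches K c (restrict y {1..K}) \<longleftrightarrow> average_reaches K c y"
  by (rule average_reaches_cong) simp

lemma pred_average_reaches [measurable (raw)]: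
  assumes "\<And>i. i \<in> {1..K} \<Longrightarrow> (\<lambda>\<omega>. Y \<omega> i) \<in> borel_measurable N"
  shows "Measurable.pred N (\<lambda>\<omega>. average_reaches K c (Y \<omega>))"
proof -
  have [measurable]: "(\<lambda>\<omega>. (\<Sum>i=1..t. Y \<omega> i) / real t) \<in> borel_measurable N" if "t \<in> {1..K}" for t
    using assms that by (intro borel_measurable_divide borel_measurable_sum) auto
  show ?thesis
    unfolding average_reaches_def by measurable
qed

lemma measurable_joint:
  assumes "\<And>i. i \<in> {1..K} \<Longrightarrow> X i \<in> borel_measurable M"
  shows "joint K X \<in> M \<rightarrow>\<^sub>M joint_space K"
  unfolding joint_def using assms by (intro measurable_restrict)

text \<open>The permutation takes finitely many values, and once it is fixed the map is a coordinate
  projection. This makes thresholds measurable as functions of the pair of e-values and \<pi>, the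
  variable from which \<open>U\<close> is independent.\<close>

lemma measurable_permuted_component:
  assumes "i \<in> {1..K}"
  shows "(\<lambda>p. fst p (snd p i)) \<in> borel_measurable (joint_space K \<Otimes>\<^sub>M perm_space K)"
proof (rule measurable_compose_countable'[where f = "\<lambda>\<sigma> p. fst p (\<sigma> i)" and g = snd])
  fix \<sigma> assume "\<sigma> \<in> {\<sigma>. \<sigma> permutes {1..K}}"
  hence "\<sigma> i \<in> {1..K}"
    using assms by (simp only: mem_Collect_eq permutes_in_image)
  thus "(\<lambda>p. fst p (\<sigma> i)) \<in> borel_measurable (joint_space K \<Otimes>\<^sub>M perm_space K)"
    by (intro measurable_compose[OF measurable_fst measurable_component_singleton])
qed (auto intro: countable_finite finite_permutations)

section \<open>The bound for the permuted e-values and its symmetry hypothesis\<close>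

text \<open>\<open>f\<close> bounds the conditional rejection probability of the third rule given the
  permuted e-values.\<close>

lemma (in prob_space) nn_integral_permuted_le:
  assumes K: "K \<ge> 1" and \<alpha>: "0 < \<alpha>"
    and X: "\<And>i. i \<in> {1..K} \<Longrightarrow> X i \<in> borel_measurable M"
    and nonneg: "\<And>i \<omega>. i \<in> {1..K} \<Longrightarrow> \<omega> \<in> space M \<Longrightarrow> 0 \<le> X i \<omega>"
    and int: "\<And>i. i \<in> {1..K} \<Longrightarrow> (\<integral>\<^sup>+\<omega>. ennreal (X i \<omega>) \<partial>M) \<le> 1"
  defines "f \<equiv> \<lambda>y. if average_reaches K (1 / \<alpha>) y then 1 else ennreal (\<alpha> * y 1)"
  assumes symm: "(\<integral>\<^sup>+\<omega>. f (joint K (\<lambda>i \<omega>. X (\<pi> \<omega> i) \<omega>) \<omega>) \<partial>M)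
      = (\<Sum>\<sigma> | \<sigma> permutes {1..K}. (\<integral>\<^sup>+\<omega>. f (joint K (\<lambda>i. X (\<sigma> i)) \<omega>) \<partial>M)) / fact K"
  shows "(\<integral>\<^sup>+\<omega>. f (joint K (\<lambda>i \<omega>. X (\<pi> \<omega> i) \<omega>) \<omega>) \<partial>M) \<le> ennreal \<alpha>"
proof -
  define S where "S = {\<sigma>. \<sigma> permutes {1..K}}"
  have finS: "finite S" and cardS: "card S = fact K"
    unfolding S_def by (auto intro: finite_permutations simp: card_permutations[where n = K])
  have S_in: "\<sigma> i \<in> {1..K}" if "\<sigma> \<in> S" "i \<in> {1..K}" for \<sigma> i
    using that by (simp only: S_def mem_Collect_eq permutes_in_image)
  have one: "1 \<in> {1..K}"
    using K by simp
  \<comment> \<open>A real-valued copy of the integrand: the counting inequality is one between real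
    sums, applied at each outcome separately, and nonnegativity carries it over to
    \<open>ennreal\<close>.\<close>
  define r where "r \<sigma> \<omega> = (if average_reaches K (1 / \<alpha>) (\<lambda>i. X (\<sigma> i) \<omega>) then 1 else \<alpha> * X (\<sigma> 1) \<omega>)"
    for \<sigma> \<omega>
  have X\<sigma> [measurable]: "X (\<sigma> i) \<in> borel_measurable M" if "\<sigma> \<in> S" "i \<in> {1..K}" for \<sigma> i
    using X S_in that by blast
  have r_meas: "(\<lambda>\<omega>. ennreal (r \<sigma> \<omega>)) \<in> borel_measurable M" if "\<sigma> \<in> S" for \<sigma>
    unfolding r_def using that one by measurable
  have nn: "0 \<le> \<alpha> * X (\<sigma> 1) \<omega>" if "\<sigma> \<in> S" "\<omega> \<in> space M" for \<sigma> \<omega>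
    using nonneg[OF S_in[OF that(1) one] that(2)] \<alpha> by simp
  have f_eq: "f (joint K (\<lambda>i. X (\<sigma> i)) \<omega>) = ennreal (r \<sigma> \<omega>)" for \<sigma> \<omega>
    unfolding f_def joint_def r_def average_reaches_restrict using one by (simp del: One_nat_def)
  have "(\<Sum>\<sigma>\<in>S. \<integral>\<^sup>+\<omega>. f (joint K (\<lambda>i. X (\<sigma> i)) \<omega>) \<partial>M) = (\<integral>\<^sup>+\<omega>. (\<Sum>\<sigma>\<in>S. ennreal (r \<sigma> \<omega>)) \<partial>M)"
    unfolding f_eq using r_meas by (simp add: nn_integral_sum)
  also have "\<dots> \<le> (\<integral>\<^sup>+\<omega>. (\<Sum>\<sigma>\<in>S. ennreal (\<alpha> * X (\<sigma> 1) \<omega>)) \<partial>M)"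
  proof (rule nn_integral_mono)
    fix \<omega> assume \<omega>: "\<omega> \<in> space M"
    have "(\<Sum>\<sigma>\<in>S. r \<sigma> \<omega>) \<le> (\<Sum>\<sigma>\<in>S. \<alpha> * X (\<sigma> 1) \<omega>)"
      using sum_permutes_running_average_le[OF \<alpha>, where x = "\<lambda>i. X i \<omega>" and K = K]
      by (simp only: r_def S_def)
    moreover have "0 \<le> r \<sigma> \<omega>" if "\<sigma> \<in> S" for \<sigma>
      using nn[OF that \<omega>] by (simp add: r_def)
    ultimately show "(\<Sum>\<sigma>\<in>S. ennreal (r \<sigma> \<omega>)) \<le> (\<Sum>\<sigma>\<in>S. ennreal (\<alpha> * X (\<sigma> 1) \<omega>))"
      using nn \<omega> by (simp add: sum_ennreal ennreal_leI)
  qed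
  also have "\<dots> = (\<Sum>\<sigma>\<in>S. \<integral>\<^sup>+\<omega>. ennreal (\<alpha> * X (\<sigma> 1) \<omega>) \<partial>M)"
    using one by (intro nn_integral_sum) auto
  also have "\<dots> \<le> (\<Sum>\<sigma>\<in>S. ennreal \<alpha>)"
  proof (rule sum_mono)
    fix \<sigma> assume \<sigma>: "\<sigma> \<in> S"
    have "(\<integral>\<^sup>+\<omega>. ennreal (\<alpha> * X (\<sigma> 1) \<omega>) \<partial>M) = ennreal \<alpha> * (\<integral>\<^sup>+\<omega>. ennreal (X (\<sigma> 1) \<omega>) \<partial>M)"
      using \<alpha> \<sigma> one by (simp add: ennreal_mult' nn_integral_cmult)
    also have "\<dots> \<le> ennreal \<alpha> * 1"
      using int[OF S_in[OF \<sigma> one]] by (intro mult_left_mono) auto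
    finally show "(\<integral>\<^sup>+\<omega>. ennreal (\<alpha> * X (\<sigma> 1) \<omega>) \<partial>M) \<le> ennreal \<alpha>"
      by simp
  qed
  also have "\<dots> = ennreal \<alpha> * fact K"
    by (simp add: cardS mult.commute)
  finally have "(\<Sum>\<sigma>\<in>S. \<integral>\<^sup>+\<omega>. f (joint K (\<lambda>i. X (\<sigma> i)) \<omega>) \<partial>M) / fact K \<le> ennreal \<alpha> * fact K / fact K"
    by (rule divide_right_mono_ennreal)
  also have "\<dots> = ennreal \<alpha>"
    using of_nat_fact[of K, where ?'a = ennreal] ennreal_of_nat_neq_top[of "fact K"]
    by (intro ennreal_mult_divide_eq) auto
  \<comment> \<open>Only here does the random order enter: \<open>symm\<close> equates the integral
    for \<pi> with the average over fixed permutations. A uniform independent \<pi> and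
    exchangeability each supply it.\<close>
  finally show ?thesis
    using symm by (simp add: S_def)
qed

lemma measurable_permuted:
  assumes "\<And>i. i \<in> {1..K} \<Longrightarrow> X i \<in> borel_measurable M" and "\<pi> \<in> M \<rightarrow>\<^sub>M perm_space K"
    and i: "i \<in> {1..K}"
  shows "(\<lambda>\<omega>. X (\<pi> \<omega> i) \<omega>) \<in> borel_measurable M"
proof (rule measurable_compose_countable'[where f = "\<lambda>\<sigma> \<omega>. X (\<sigma> i) \<omega>" and g = \<pi>])
  fix \<sigma> assume "\<sigma> \<in> {\<sigma>. \<sigma> permutes {1..K}}"
  hence "\<sigma> i \<in> {1..K}"
    using i by (simp only: mem_Collect_eq permutes_in_image)
  thus "(\<lambda>\<omega>. X (\<sigma> i) \<omega>) \<in> borel_measurable M"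
    using assms(1) by simp
qed (use assms in \<open>auto intro: countable_finite finite_permutations\<close>)

text \<open>The threshold is computed from a variable \<open>V\<close> independent of
  \<open>U\<close>. With \<open>V\<close> the pair of e-values and \<pi>, this covers both rules
  that use \<open>U\<close>.\<close>

lemma (in prob_space) emeasure_uniform_unit_compose_le:
  assumes U: "uniform_unit M U" "random_variable borel U"
    and V: "V \<in> M \<rightarrow>\<^sub>M N" and indep: "independent_rvs M borel U N V"
    and w: "w \<in> borel_measurable N"
  shows "emeasure M {\<omega> \<in> space M. U \<omega> \<le> w (V \<omega>)} \<le> (\<integral>\<^sup>+\<omega>. ennreal (w (V \<omega>)) \<partial>M)"
  using independent_rvs_imp_indep_var[OF indep U(2) V measurable_ident w]
  by (intro emeasure_uniform_unit_le U(1)) (simp add: id_def)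

text \<open>The permuted vector is a function of \<pi> and of the unpermuted joint vector, which are
  independent by assumption, so the averaging formula for a uniform permutation applies.\<close>

lemma (in prob_space) nn_integral_joint_permuted:
  assumes X: "\<And>i. i \<in> {1..K} \<Longrightarrow> X i \<in> borel_measurable M"
    and \<pi>: "\<pi> \<in> M \<rightarrow>\<^sub>M perm_space K"
    and unif: "uniform_perm M K \<pi>"
    and indep: "independent_rvs M (perm_space K) \<pi> (joint_space K) (joint K X)"
    and f: "f \<in> borel_measurable (joint_space K)"
  shows "(\<integral>\<^sup>+\<omega>. f (joint K (\<lambda>i \<omega>. X (\<pi> \<omega> i) \<omega>) \<omega>) \<partial>M)
    = (\<Sum>\<sigma> | \<sigma> permutes {1..K}. (\<integral>\<^sup>+\<omega>. f (joint K (\<lambda>i. X (\<sigma> i)) \<omega>) \<partial>M)) / fact K"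
proof -
  define g where "g \<sigma> x = f (\<lambda>i\<in>{1..K}. x (\<sigma> i))" for \<sigma> :: "nat \<Rightarrow> nat" and x :: "nat \<Rightarrow> real"
  have in_range: "\<sigma> i \<in> {1..K}" if "\<sigma> permutes {1..K}" "i \<in> {1..K}" for \<sigma> i
    using that by (simp only: permutes_in_image)
  have g: "g \<sigma> \<in> borel_measurable (joint_space K)" if "\<sigma> permutes {1..K}" for \<sigma>
  proof -
    have "(\<lambda>x. \<lambda>i\<in>{1..K}. x (\<sigma> i)) \<in> joint_space K \<rightarrow>\<^sub>M joint_space K"
      by (rule measurable_restrict) (rule measurable_component_singleton[OF in_range[OF that]])
    from measurable_compose[OF this f] show ?thesis
      unfolding g_def .
  qed
  have g_joint: "g \<sigma> (joint K X \<omega>) = f (joint K (\<lambda>i. X (\<sigma> i)) \<omega>)" if "\<sigma> permutes {1..K}" for \<sigma> \<omega>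
    unfolding g_def joint_def using in_range[OF that]
    by (intro arg_cong[where f = f] restrict_ext) (simp del: atLeastAtMost_iff)
  have g_\<pi>: "g (\<pi> \<omega>) (joint K X \<omega>) = f (joint K (\<lambda>i \<omega>. X (\<pi> \<omega> i) \<omega>) \<omega>)" if "\<omega> \<in> space M" for \<omega>
    using g_joint[of "\<pi> \<omega>" \<omega>] measurable_space[OF \<pi> that] by (simp add: joint_def)
  have "(\<integral>\<^sup>+\<omega>. f (joint K (\<lambda>i \<omega>. X (\<pi> \<omega> i) \<omega>) \<omega>) \<partial>M) = (\<integral>\<^sup>+\<omega>. g (\<pi> \<omega>) (joint K X \<omega>) \<partial>M)"
    by (intro nn_integral_cong) (simp add: g_\<pi>)
  also have "\<dots> = (\<Sum>\<sigma> | \<sigma> permutes {1..K}. (\<integral>\<^sup>+\<omega>. g \<sigma> (joint K X \<omega>) \<partial>M)) / fact K"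
    by (rule nn_integral_uniform_perm[OF \<pi> unif measurable_joint[OF X] indep g])
  also have "\<dots> = (\<Sum>\<sigma> | \<sigma> permutes {1..K}. (\<integral>\<^sup>+\<omega>. f (joint K (\<lambda>i. X (\<sigma> i)) \<omega>) \<partial>M)) / fact K"
    by (intro arg_cong[where f = "\<lambda>s. s / fact K"] sum.cong refl) (simp add: g_joint del: One_nat_def)
  finally show ?thesis .
qed

text \<open>Exchangeability makes all K! integrals on the right equal to the one on the left.
  Writing this as an average gives the identity the same shape as for a random \<pi>.\<close>

lemma (in prob_space) nn_integral_joint_exchangeable:
  assumes X: "\<And>i. i \<in> {1..K} \<Longrightarrow> X i \<in> borel_measurable M"
    and exch: "exchangeable {M} K X"
    and f: "f \<in> borel_measurable (joint_space K)"
  shows "(\<integral>\<^sup>+\<omega>. f (joint K X \<omega>) \<partial>M)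
    = (\<Sum>\<sigma> | \<sigma> permutes {1..K}. (\<integral>\<^sup>+\<omega>. f (joint K (\<lambda>i. X (\<sigma> i)) \<omega>) \<partial>M)) / fact K"
proof -
  have J: "joint K X \<in> M \<rightarrow>\<^sub>M joint_space K"
    by (rule measurable_joint) (rule X)
  have "(\<integral>\<^sup>+\<omega>. f (joint K (\<lambda>i. X (\<sigma> i)) \<omega>) \<partial>M) = (\<integral>\<^sup>+\<omega>. f (joint K X \<omega>) \<partial>M)"
    if \<sigma>: "\<sigma> permutes {1..K}" for \<sigma>
  proof -
    have "\<sigma> i \<in> {1..K}" if "i \<in> {1..K}" for i
      using \<sigma> that by (simp only: permutes_in_image)
    hence J\<sigma>: "joint K (\<lambda>i. X (\<sigma> i)) \<in> M \<rightarrow>\<^sub>M joint_space K"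
      using X by (intro measurable_joint) blast
    have "(\<integral>\<^sup>+\<omega>. f (joint K (\<lambda>i. X (\<sigma> i)) \<omega>) \<partial>M)
        = (\<integral>\<^sup>+x. f x \<partial>distr M (joint_space K) (joint K (\<lambda>i. X (\<sigma> i))))"
      by (simp add: nn_integral_distr[OF J\<sigma>] f del: One_nat_def)
    also have "\<dots> = (\<integral>\<^sup>+x. f x \<partial>distr M (joint_space K) (joint K X))"
      using exch \<sigma> by (simp add: exchangeable_def)
    also have "\<dots> = (\<integral>\<^sup>+\<omega>. f (joint K X \<omega>) \<partial>M)"
      by (simp add: nn_integral_distr[OF J] f del: One_nat_def)
    finally show ?thesis .
  qed
  hence "(\<Sum>\<sigma> | \<sigma> permutes {1..K}. (\<integral>\<^sup>+\<omega>. f (joint K (\<lambda>i. X (\<sigma> i)) \<omega>) \<partial>M))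
      = (\<integral>\<^sup>+\<omega>. f (joint K X \<omega>) \<partial>M) * fact K"
    by (simp add: card_permutations[where n = K] mult.commute)
  moreover have "(fact K :: ennreal) \<noteq> 0" "(fact K :: ennreal) \<noteq> \<top>"
    using of_nat_fact[of K, where ?'a = ennreal] ennreal_of_nat_neq_top[of "fact K"] by auto
  ultimately show ?thesis
    by (simp add: ennreal_mult_divide_eq)
qed

section \<open>Type-I error and power of the three rules\<close>

theorem proposition6p1:
  fixes M :: "'a measure" and \<P> :: "'a measure set"
    and K :: nat and \<alpha> :: real
    and X :: "nat \<Rightarrow> 'a \<Rightarrow> real"
    and \<pi> :: "'a \<Rightarrow> nat \<Rightarrow> nat"
    and U :: "'a \<Rightarrow> real"
  assumes null: "\<And>P. P \<in> \<P> \<Longrightarrow> prob_space P \<and> sets P = sets M"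
    and K: "K \<ge> 1"
    and alpha: "0 < \<alpha>" "\<alpha> < 1"
    and e_values: "\<And>i. i \<in> {1..K} \<Longrightarrow> e_value M \<P> (X i)"
    and perm_meas: "\<pi> \<in> M \<rightarrow>\<^sub>M perm_space K"
    and perm_not_exch: "\<not> exchangeable \<P> K X \<Longrightarrow>
          (\<forall>P\<in>\<P>. uniform_perm P K \<pi> \<and>
                  independent_rvs P (perm_space K) \<pi> (joint_space K) (joint K X))"
    and perm_exch: "exchangeable \<P> K X \<Longrightarrow> (\<forall>\<omega>\<in>space M. \<pi> \<omega> = id)"
    and U_meas: "U \<in> M \<rightarrow>\<^sub>M restrict_space borel {0..1}"
    and U_uniform: "\<And>P. P \<in> \<P> \<Longrightarrow> uniform_unit P U"
    and U_indep: "\<And>P. P \<in> \<P> \<Longrightarrow>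
          independent_rvs P borel U
            (joint_space K \<Otimes>\<^sub>M perm_space K) (\<lambda>\<omega>. (joint K X \<omega>, \<pi> \<omega>))"
  shows "controls_type_I_error \<P> \<alpha> (rule_randomized K \<alpha> X U) \<and>
    controls_type_I_error \<P> \<alpha> (rule_permuted K \<alpha> X \<pi>) \<and>
    controls_type_I_error \<P> \<alpha> (rule_permuted_randomized K \<alpha> X \<pi> U) \<and>
    more_powerful M (rule_randomized K \<alpha> X U) (rule_plain K \<alpha> X) \<and>
    more_powerful M (rule_permuted K \<alpha> X \<pi>) (rule_plain K \<alpha> X) \<and>
    more_powerful M (rule_permuted_randomized K \<alpha> X \<pi> U) (rule_plain K \<alpha> X)"
proof -
  have X: "X i \<in> borel_measurable M" "\<And>\<omega>. \<omega> \<in> space M \<Longrightarrow> 0 \<le> X i \<omega>" if "i \<in> {1..K}" for i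
    using e_values[OF that] by (auto simp: e_value_def)
  have one: "1 \<in> {1..K}"
    using K by simp
  \<comment> \<open>These bounds hold at every outcome and not just almost surely: the comparison of
    power is outcome by outcome, and so is the later exclusion of outcomes by a negative
    threshold.\<close>
  have U01: "0 \<le> U \<omega>" "U \<omega> \<le> 1" if "\<omega> \<in> space M" for \<omega>
    using measurable_space[OF U_meas that] by auto
  have \<pi>_perm: "\<pi> \<omega> permutes {1..K}" if "\<omega> \<in> space M" for \<omega>
    using measurable_space[OF perm_meas that] by simp
  \<comment> \<open>The average of all \<open>K\<close> values ignores their order, so the statistic
    of the plain rule is the term \<open>t = K\<close> of the supremum.\<close>
  have avg_eq: "perm_avg X \<pi> K \<omega> = avg X K \<omega>" if "\<omega> \<in> space M" for \<omega>
    using sum.permute[OF \<pi>_perm[OF that], of "\<lambda>i. X i \<omega>"] by (simp add: perm_avg_def avg_def o_def)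
  have avg_le_SUP: "avg X K \<omega> \<le> (SUP t\<in>{1..K}. perm_avg X \<pi> t \<omega>)" if "\<omega> \<in> space M" for \<omega>
    using K by (subst avg_eq[OF that, symmetric]) (intro cSUP_upper bdd_above_finite; simp)

  \<comment> \<open>The three rules are treated together because the bound for the second follows
    from that for the third, whose rejection event is larger.\<close>
  have main: "{\<omega> \<in> space P. R \<omega>} \<in> sets P \<and> measure P {\<omega> \<in> space P. R \<omega>} \<le> \<alpha>"
    if P: "P \<in> \<P>" and R: "R = rule_randomized K \<alpha> X U \<or> R = rule_permuted K \<alpha> X \<pi>
      \<or> R = rule_permuted_randomized K \<alpha> X \<pi> U" for P R
  proof -
    interpret prob_space P
      using null[OF P] by simp
    have sets [measurable_cong]: "sets P = sets M"
      using null[OF P] by simp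
    have space: "space P = space M"
      by (rule sets_eq_imp_space_eq[OF sets])
    have XP [measurable]: "X i \<in> borel_measurable P" if "i \<in> {1..K}" for i
      using X(1)[OF that] by measurable
    have \<pi>P: "\<pi> \<in> P \<rightarrow>\<^sub>M perm_space K"
      using perm_meas by measurable
    have "U \<in> borel_measurable M"
      using U_meas by (simp add: measurable_restrict_space2_iff)
    hence UP [measurable]: "U \<in> borel_measurable P"
      by measurable
    have X_nonneg: "0 \<le> X i \<omega>" if "i \<in> {1..K}" "\<omega> \<in> space P" for i \<omega>
      using X(2) that space by simp
    have int: "(\<integral>\<^sup>+\<omega>. ennreal (X i \<omega>) \<partial>P) \<le> 1" if "i \<in> {1..K}" for i
    proof -
      have "(\<integral>\<^sup>+\<omega>. ennreal (X i \<omega>) \<partial>P) = ennreal (integral\<^sup>L P (X i))"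
        using e_values[OF that] P X_nonneg[OF that]
        by (intro nn_integral_eq_integral) (auto simp: e_value_def)
      also have "\<dots> \<le> 1"
        using e_values[OF that] P by (auto simp: e_value_def)
      finally show ?thesis .
    qed
    let ?V = "\<lambda>\<omega>. (joint K X \<omega>, \<pi> \<omega>)"
    have V: "?V \<in> P \<rightarrow>\<^sub>M joint_space K \<Otimes>\<^sub>M perm_space K"
      by (intro measurable_Pair measurable_joint \<pi>P) measurable
    have J: "fst (?V \<omega>) i = X i \<omega>" if "i \<in> {1..K}" for \<omega> i
      using that by (simp add: joint_def)
    have J\<pi>: "fst (?V \<omega>) (snd (?V \<omega>) i) = X (\<pi> \<omega> i) \<omega>" if "i \<in> {1..K}" "\<omega> \<in> space P" for \<omega> i
      using permutes_in_image[OF \<pi>_perm, of \<omega> i] that space by (simp add: joint_def)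
    have Y [measurable]: "(\<lambda>\<omega>. X (\<pi> \<omega> i) \<omega>) \<in> borel_measurable P" if "i \<in> {1..K}" for i
      by (rule measurable_permuted[OF XP \<pi>P that])
    note U_bound = emeasure_uniform_unit_compose_le[OF U_uniform[OF P] UP V U_indep[OF P]]

    have randomized: "emeasure P {\<omega> \<in> space P. U \<omega> / \<alpha> \<le> avg X K \<omega>} \<le> ennreal \<alpha>"
    proof -
      \<comment> \<open>This is \<alpha> times the average, spread over the coordinates: each
        e-value has expectation at most 1 and the \<open>K\<close> weights add up to
        \<alpha>.\<close>
      define w where "w p = (\<Sum>i=1..K. \<alpha> / real K * fst p i)" for p :: "(nat \<Rightarrow> real) \<times> (nat \<Rightarrow> nat)"
      have w: "w \<in> borel_measurable (joint_space K \<Otimes>\<^sub>M perm_space K)"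
        unfolding w_def
        by (intro borel_measurable_sum borel_measurable_times borel_measurable_const
            measurable_compose[OF measurable_fst measurable_component_singleton])
      have wV: "w (?V \<omega>) = (\<Sum>i=1..K. \<alpha> / real K * X i \<omega>)" for \<omega>
        unfolding w_def by (intro sum.cong refl) (simp only: J)
      have wV_avg: "(\<Sum>i=1..K. \<alpha> / real K * X i \<omega>) = \<alpha> * avg X K \<omega>" for \<omega>
        by (simp add: avg_def sum_distrib_left sum_divide_distrib)
      have "{\<omega> \<in> space P. U \<omega> / \<alpha> \<le> avg X K \<omega>} = {\<omega> \<in> space P. U \<omega> \<le> w (?V \<omega>)}"
        unfolding wV wV_avg using alpha by (simp add: pos_divide_le_eq mult.commute)
      hence "emeasure P {\<omega> \<in> space P. U \<omega> / \<alpha> \<le> avg X K \<omega>} \<le> (\<integral>\<^sup>+\<omega>. ennreal (w (?V \<omega>)) \<partial>P)"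
        using U_bound[OF w] by simp
      also have "\<dots> = (\<integral>\<^sup>+\<omega>. (\<Sum>i=1..K. ennreal (\<alpha> / real K) * ennreal (X i \<omega>)) \<partial>P)"
      proof (rule nn_integral_cong)
        fix \<omega> assume "\<omega> \<in> space P"
        hence "ennreal (w (?V \<omega>)) = (\<Sum>i=1..K. ennreal (\<alpha> / real K * X i \<omega>))"
          unfolding wV using X_nonneg alpha(1)
          by (intro sum_ennreal[symmetric] mult_nonneg_nonneg divide_nonneg_nonneg) auto
        also have "\<dots> = (\<Sum>i=1..K. ennreal (\<alpha> / real K) * ennreal (X i \<omega>))"
          using alpha(1) by (intro sum.cong refl ennreal_mult') simp
        finally show "ennreal (w (?V \<omega>)) = (\<Sum>i=1..K. ennreal (\<alpha> / real K) * ennreal (X i \<omega>))" .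
      qed
      also have "\<dots> = (\<Sum>i=1..K. ennreal (\<alpha> / real K) * (\<integral>\<^sup>+\<omega>. ennreal (X i \<omega>) \<partial>P))"
        by (subst nn_integral_sum)
          (auto intro!: sum.cong nn_integral_cmult measurable_compose[OF XP measurable_ennreal])
      also have "\<dots> \<le> (\<Sum>i=1..K. ennreal (\<alpha> / real K) * 1)"
        by (intro sum_mono mult_left_mono int) auto
      also have "\<dots> = ennreal \<alpha>"
        using K alpha by (simp add: ennreal_of_nat_eq_real_of_nat flip: ennreal_mult)
      finally show ?thesis .
    qed

    let ?reach = "\<lambda>\<omega>. average_reaches K (1 / \<alpha>) (\<lambda>i. X (\<pi> \<omega> i) \<omega>)"
    have reach_meas [measurable]: "Measurable.pred P ?reach"
      by (intro pred_average_reaches Y)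
    have permuted: "emeasure P {\<omega> \<in> space P. U \<omega> / \<alpha> \<le> X (\<pi> \<omega> 1) \<omega> \<or> ?reach \<omega>} \<le> ennreal \<alpha>"
    proof -
      define f where "f = (\<lambda>y. if average_reaches K (1 / \<alpha>) y then 1 else ennreal (\<alpha> * y 1))"
      have f: "f \<in> borel_measurable (joint_space K)"
        unfolding f_def using one by measurable
      have symm: "(\<integral>\<^sup>+\<omega>. f (joint K (\<lambda>i \<omega>. X (\<pi> \<omega> i) \<omega>) \<omega>) \<partial>P)
          = (\<Sum>\<sigma> | \<sigma> permutes {1..K}. (\<integral>\<^sup>+\<omega>. f (joint K (\<lambda>i. X (\<sigma> i)) \<omega>) \<partial>P)) / fact K"
      \<comment> \<open>The dichotomy concerns the whole family: if exchangeability fails under some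
        member, \<pi> is uniform and independent under every member, in particular under
        \<open>P\<close>.\<close>
      proof (cases "exchangeable \<P> K X")
        case True
        have "(\<integral>\<^sup>+\<omega>. f (joint K (\<lambda>i \<omega>. X (\<pi> \<omega> i) \<omega>) \<omega>) \<partial>P) = (\<integral>\<^sup>+\<omega>. f (joint K X \<omega>) \<partial>P)"
          using perm_exch[OF True] space by (intro nn_integral_cong) (simp add: joint_def)
        also have "\<dots> = (\<Sum>\<sigma> | \<sigma> permutes {1..K}. (\<integral>\<^sup>+\<omega>. f (joint K (\<lambda>i. X (\<sigma> i)) \<omega>) \<partial>P)) / fact K"
          using True P by (intro nn_integral_joint_exchangeable f) (auto simp: exchangeable_def)
        finally show ?thesis .
      next
        case False
        thus ?thesis
          using perm_not_exch P by (intro nn_integral_joint_permuted \<pi>P f) auto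
      qed
      define w where "w p = (if average_reaches K (1 / \<alpha>) (\<lambda>i. fst p (snd p i)) then -1
          else \<alpha> * fst p (snd p 1))" for p :: "(nat \<Rightarrow> real) \<times> (nat \<Rightarrow> nat)"
        \<comment> \<open>As \<open>U \<ge> 0\<close>, the value \<open>-1\<close> removes the event already counted by \<open>?reach\<close>.\<close>
      have w: "w \<in> borel_measurable (joint_space K \<Otimes>\<^sub>M perm_space K)"
      proof -
        have [measurable]: "Measurable.pred (joint_space K \<Otimes>\<^sub>M perm_space K)
            (\<lambda>p. average_reaches K (1 / \<alpha>) (\<lambda>i. fst p (snd p i)))"
          by (intro pred_average_reaches measurable_permuted_component)
        note measurable_permuted_component[OF one, measurable]
        show ?thesis
          unfolding w_def by measurable
      qed
      have wV: "w (?V \<omega>) = (if ?reach \<omega> then -1 else \<alpha> * X (\<pi> \<omega> 1) \<omega>)" if "\<omega> \<in> space P" for \<omega>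
      proof -
        have "average_reaches K (1 / \<alpha>) (\<lambda>i. fst (?V \<omega>) (snd (?V \<omega>) i)) = ?reach \<omega>"
          by (rule average_reaches_cong) (rule J\<pi>[OF _ that])
        thus ?thesis
          unfolding w_def using J\<pi>[OF one that] by simp
      qed
      have f_joint: "f (joint K (\<lambda>i \<omega>. X (\<pi> \<omega> i) \<omega>) \<omega>)
          = (if ?reach \<omega> then 1 else ennreal (\<alpha> * X (\<pi> \<omega> 1) \<omega>))" for \<omega>
        unfolding f_def joint_def average_reaches_restrict using one by (simp del: One_nat_def)
      have wV_meas [measurable]: "(\<lambda>\<omega>. w (?V \<omega>)) \<in> borel_measurable P"
        by (rule measurable_compose[OF V w])
      have reach_sets: "{\<omega> \<in> space P. ?reach \<omega>} \<in> sets P"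
        by measurable
      have le_sets: "{\<omega> \<in> space P. U \<omega> \<le> w (?V \<omega>)} \<in> sets P"
        by measurable
      have "{\<omega> \<in> space P. U \<omega> / \<alpha> \<le> X (\<pi> \<omega> 1) \<omega> \<or> ?reach \<omega>}
          = {\<omega> \<in> space P. ?reach \<omega>} \<union> {\<omega> \<in> space P. U \<omega> \<le> w (?V \<omega>)}"
        using U01(1) space alpha
        by (auto simp: wV pos_divide_le_eq mult.commute split: if_splits simp del: fst_conv snd_conv)
      hence "emeasure P {\<omega> \<in> space P. U \<omega> / \<alpha> \<le> X (\<pi> \<omega> 1) \<omega> \<or> ?reach \<omega>}
          \<le> emeasure P {\<omega> \<in> space P. ?reach \<omega>} + emeasure P {\<omega> \<in> space P. U \<omega> \<le> w (?V \<omega>)}"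
        using emeasure_subadditive[OF reach_sets le_sets] by (simp only:)
      also have "\<dots> \<le> emeasure P {\<omega> \<in> space P. ?reach \<omega>} + (\<integral>\<^sup>+\<omega>. ennreal (w (?V \<omega>)) \<partial>P)"
        by (rule add_left_mono[OF U_bound[OF w]])
      also have "\<dots> = (\<integral>\<^sup>+\<omega>. indicator {\<omega> \<in> space P. ?reach \<omega>} \<omega> + ennreal (w (?V \<omega>)) \<partial>P)"
        using reach_sets by (subst nn_integral_add) simp_all
      \<comment> \<open>On \<open>?reach\<close> the indicator gives 1 and
        \<open>ennreal (-1)\<close> vanishes; off it only \<alpha> times the first permuted e-value
        remains. The sum is therefore exactly \<open>f\<close>.\<close>
      also have "\<dots> = (\<integral>\<^sup>+\<omega>. f (joint K (\<lambda>i \<omega>. X (\<pi> \<omega> i) \<omega>) \<omega>) \<partial>P)"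
        by (intro nn_integral_cong) (simp add: wV f_joint ennreal_neg)
      also have "\<dots> \<le> ennreal \<alpha>"
        unfolding f_def by (rule nn_integral_permuted_le[OF K alpha(1) XP X_nonneg int symm[unfolded f_def]])
      finally show ?thesis .
    qed

    from R consider "R = rule_randomized K \<alpha> X U" | "R = rule_permuted K \<alpha> X \<pi>"
      | "R = rule_permuted_randomized K \<alpha> X \<pi> U" by blast
    hence "{\<omega> \<in> space P. R \<omega>} \<in> sets P \<and> emeasure P {\<omega> \<in> space P. R \<omega>} \<le> ennreal \<alpha>"
    proof cases
      case 1
      thus ?thesis
        using randomized by (simp add: rule_randomized_def avg_def)
    next
      case 2
      have "emeasure P {\<omega> \<in> space P. ?reach \<omega>}
          \<le> emeasure P {\<omega> \<in> space P. U \<omega> / \<alpha> \<le> X (\<pi> \<omega> 1) \<omega> \<or> ?reach \<omega>}"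
        using one by (intro emeasure_mono) auto
      with 2 permuted show ?thesis
        by (simp add: rule_permuted_def SUP_perm_avg_ge_iff[OF K] del: One_nat_def)
    next
      case 3
      with permuted one show ?thesis
        by (simp add: rule_permuted_randomized_def SUP_perm_avg_ge_iff[OF K] del: One_nat_def)
    qed
    thus ?thesis
      using alpha by (simp add: emeasure_eq_measure)
  qed

  have "more_powerful M (rule_randomized K \<alpha> X U) (rule_plain K \<alpha> X)"
    unfolding more_powerful_def rule_randomized_def rule_plain_def
    using U01(2) alpha by (meson divide_right_mono less_imp_le order_trans)
  moreover have "more_powerful M (rule_permuted K \<alpha> X \<pi>) (rule_plain K \<alpha> X)"
    unfolding more_powerful_def rule_permuted_def rule_plain_def
    using avg_le_SUP order_trans by blast
  moreover from this have "more_powerful M (rule_permuted_randomized K \<alpha> X \<pi> U) (rule_plain K \<alpha> X)"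
    by (simp add: more_powerful_def rule_permuted_def rule_permuted_randomized_def)
  ultimately show ?thesis
    unfolding controls_type_I_error_def by (intro conjI ballI main; simp)
qed

end
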